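(* For $a\in\mathbb C\setminus\mathbb R$, the Hopf circles $S^1\times\{0\}$ and $\{0\}\times S^1$ are the only closed leaves of $\mathcal F^a$. Every other leaf is asymptotic to the two Hopf circles, one at either end. For $a\in(0,1)$, all leaves of $\mathcal F^a$ apart from the Hopf circles are curves of constant slope $a/(1-a)$ on the Hopf tori $\{|z_1|=\mathrm{const.}\}$, regarded as boundary of a tubular neighbourhood of the Hopf circle $S^1\times\{0\}$.
   Context: $S^3\subset\mathbb C^2$ is the unit sphere, and $z_j=r_j\mathrm e^{\mathrm i\theta_j}$. For $a\in(\mathbb C\setminus\mathbb R)\cup(0,1)$, $\mathcal F^a$ is the $1$-dimensional foliation of $S^3$ tangent to the common kernel of the real and imaginary parts of the restriction to $TS^3$ of $\omega^a=az_1\,\mathrm dz_2-(1-a)z_2\,\mathrm dz_1$; both Hopf circles $S^1\times\{0\}=\{z_2=0\}\cap S^3$ and $\{0\}\times S^1=\{z_1=0\}\cap S^3$ are leaves. A non-closed leaf, parametrised as an orbit over $\mathbb R$, is asymptotic to a circle at one end if the distance of its points to that circle tends to $0$ as the parameter tends to the corresponding end of $\mathbb R$. On a Hopf torus $\{r_1=\mathrm{const.}\}$, $0<r_1<1$, viewed as the boundary of a tubular neighbourhood of $S^1\times\{0\}$, $\theta_2$ is the meridional and $\theta_1$ the longitudinal angular coordinate, and slope is longitudinal over meridional, i.e. $\mathrm d\theta_1/\mathrm d\theta_2$; so a curve of constant slope $a/(1-a)$ is one given by $\theta_2-\frac{1-a}{a}\theta_1=\mathrm{const}$. *)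

theory Defs
  imports "HOL-Analysis.Analysis"
begin

text \<open>The inner product and the norm of \<^typ>\<open>complex \<times> complex\<close> are the Euclidean ones.\<close>

abbreviation S3 :: "(complex \<times> complex) set" where
  "S3 \<equiv> sphere 0 1"

definition tangent_S3 :: "complex \<times> complex \<Rightarrow> (complex \<times> complex) set" where
  "tangent_S3 p = {v. p \<bullet> v = 0}"

definition omega :: "complex \<Rightarrow> complex \<times> complex \<Rightarrow> complex \<times> complex \<Rightarrow> complex" where
  "omega a p v = a * fst p * snd v - (1 - a) * snd p * fst v"

definition foliation_dir :: "complex \<Rightarrow> complex \<times> complex \<Rightarrow> (complex \<times> complex) set" where
  "foliation_dir a p = {v \<in> tangent_S3 p. Re (omega a p v) = 0 \<and> Im (omega a p v) = 0}"

definition tangent_curve_on :: "complex \<Rightarrow> real set \<Rightarrow> (real \<Rightarrow> complex \<times> complex) \<Rightarrow> bool" where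
  "tangent_curve_on a I \<gamma> \<longleftrightarrow> \<gamma> C1_differentiable_on I \<and>
     (\<forall>t\<in>I. \<gamma> t \<in> S3 \<and> vector_derivative \<gamma> (at t) \<in> foliation_dir a (\<gamma> t))"

text \<open>The leaf through \<open>p\<close> consists of the points that can be joined to \<open>p\<close> by a path tangent
  to the foliation. The paths need not be regular; in particular \<open>p\<close> itself is joined to \<open>p\<close>
  by the constant path.\<close>

definition leaf :: "complex \<Rightarrow> complex \<times> complex \<Rightarrow> (complex \<times> complex) set" where
  "leaf a p = {q. \<exists>\<gamma>. tangent_curve_on a {0..1} \<gamma> \<and> \<gamma> 0 = p \<and> \<gamma> 1 = q}"

definition leaves :: "complex \<Rightarrow> (complex \<times> complex) set set" where
  "leaves a = leaf a ` S3"

text \<open>Parametrisation of a leaf as an orbit over the real line: a regular tangent curve running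
  through the whole leaf. On a non-closed leaf such a curve is automatically injective.\<close>

definition orbit_param ::
    "complex \<Rightarrow> (complex \<times> complex) set \<Rightarrow> (real \<Rightarrow> complex \<times> complex) \<Rightarrow> bool" where
  "orbit_param a L \<gamma> \<longleftrightarrow> tangent_curve_on a UNIV \<gamma> \<and>
     (\<forall>t. vector_derivative \<gamma> (at t) \<noteq> 0) \<and> range \<gamma> = L"

definition closed_leaf :: "complex \<Rightarrow> (complex \<times> complex) set \<Rightarrow> bool" where
  "closed_leaf a L \<longleftrightarrow> L \<in> leaves a \<and>
     (\<exists>\<gamma> T. orbit_param a L \<gamma> \<and> T > 0 \<and> (\<forall>t. \<gamma> (t + T) = \<gamma> t))"

definition hopf1 :: "(complex \<times> complex) set" where
  "hopf1 = sphere 0 1 \<times> {0}"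

definition hopf2 :: "(complex \<times> complex) set" where
  "hopf2 = {0} \<times> sphere 0 1"

text \<open>The filter \<open>F\<close> selects the end: \<^term>\<open>at_bot\<close> or \<^term>\<open>at_top\<close>.\<close>

definition asymptotic_to ::
    "(real \<Rightarrow> complex \<times> complex) \<Rightarrow> (complex \<times> complex) set \<Rightarrow> real filter \<Rightarrow> bool" where
  "asymptotic_to \<gamma> C F \<longleftrightarrow> ((\<lambda>t. infdist (\<gamma> t) C) \<longlongrightarrow> 0) F"

text \<open>The leaf has an orbit parametrisation, and every such parametrisation (in either direction)
  approaches one of the two sets at one end and the other one at the other end.\<close>

definition leaf_asymptotic_to_both ::
    "complex \<Rightarrow> (complex \<times> complex) set \<Rightarrow> (complex \<times> complex) set \<Rightarrow> (complex \<times> complex) set \<Rightarrow> bool" where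
  "leaf_asymptotic_to_both a L C C' \<longleftrightarrow> (\<exists>\<gamma>. orbit_param a L \<gamma>) \<and>
     (\<forall>\<gamma>. orbit_param a L \<gamma> \<longrightarrow>
        (asymptotic_to \<gamma> C at_bot \<and> asymptotic_to \<gamma> C' at_top) \<or>
        (asymptotic_to \<gamma> C' at_bot \<and> asymptotic_to \<gamma> C at_top))"

definition hopf_torus :: "real \<Rightarrow> (complex \<times> complex) set" where
  "hopf_torus r = {z \<in> S3. cmod (fst z) = r}"

definition torus_point :: "real \<Rightarrow> real \<Rightarrow> real \<Rightarrow> complex \<times> complex" where
  "torus_point r \<theta>1 \<theta>2 = (of_real r * cis \<theta>1, of_real (sqrt (1 - r\<^sup>2)) * cis \<theta>2)"

text \<open>Slope is longitudinal over meridional with respect to the solid torus around \<^term>\<open>hopf1\<close>,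
  that is, \<open>d\<theta>1 / d\<theta>2\<close>. The angles range over the real line, so \<open>\<theta>2 - \<theta>1 / s = c\<close> describes a
  single (connected) curve on the torus.\<close>

definition slope_curve :: "real \<Rightarrow> real \<Rightarrow> real \<Rightarrow> (complex \<times> complex) set" where
  "slope_curve r s c = {torus_point r \<theta>1 \<theta>2 | \<theta>1 \<theta>2. \<theta>2 - \<theta>1 / s = c}"

end

theory Submission imports Defs begin

text \<open>
  The form \<open>\<omega>\<^sup>a\<close> is defined on all of \<open>\<complex>\<^sup>2\<close>, and away from the origin its kernel is the complex
  line spanned by the linear vector field \<open>(a z\<^sub>1, (1 - a) z\<^sub>2)\<close>. The complex flow of this field is
  \<open>w \<mapsto> (z\<^sub>1 exp (a w), z\<^sub>2 exp ((1 - a) w))\<close>, and the leaf through \<open>p \<in> S\<^sup>3\<close> is the part of the complex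
  orbit of \<open>p\<close> that lies on the sphere. For one inclusion, a tangent curve solves
  \<open>z\<^sub>1' = a \<lambda> z\<^sub>1\<close>, \<open>z\<^sub>2' = (1 - a) \<lambda> z\<^sub>2\<close> with a continuous function \<open>\<lambda>\<close>, and hence moves along
  the flow with the complex time \<open>\<integral> \<lambda>\<close> (\<open>tangent_curve_endpoint\<close>). For the other one, it suffices that the
  set of complex times \<open>w\<close> at which the orbit of \<open>p\<close> meets the sphere is a regularly parametrised curve; the
  flow then carries this curve to a parametrisation of the leaf (\<open>orbit_param_linear_flow\<close>). So
  each case of the theorem comes down to the real equation
  \<open>r\<^sub>1\<^sup>2 exp (2 Re (a w)) + r\<^sub>2\<^sup>2 exp (2 Re ((1 - a) w)) = 1\<close>.

  On a Hopf circle one of the two terms is absent and the solutions form a line. For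
  \<open>a \<in> (0, 1)\<close> the left side is strictly increasing in \<open>Re w\<close>, so the solutions are the imaginary axis;
  the flow then preserves both moduli and turns the two angles at the rates \<open>a\<close> and \<open>1 - a\<close>,
  which gives the slope. For \<open>a\<close> not real and \<open>p\<close> on neither Hopf circle, \<open>Re (a w)\<close> and \<open>Re ((1 - a) w)\<close> are real
  coordinates of the plane of complex times, and in these coordinates the solutions form an open arc on which
  \<open>|z\<^sub>1|\<^sup>2\<close> takes all values in \<open>(0, 1)\<close>. Along any orbit parametrisation of such a leaf \<open>|z\<^sub>1|\<^sup>2\<close> has no critical
  point, so it is strictly monotone; its limits at the two ends are \<open>0\<close> and \<open>1\<close>, which means that the
  ends approach the two Hopf circles (\<open>orbit_param_asymptotic\<close>). A periodic parametrisation with this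
  behaviour would lie in both circles at once, so such a leaf is not closed.
\<close>

section \<open>The complex linear flow and tangent curves\<close>

definition linear_flow :: "complex \<Rightarrow> complex \<Rightarrow> complex \<times> complex \<Rightarrow> complex \<times> complex" where
  "linear_flow a w p = (fst p * exp (a * w), snd p * exp ((1 - a) * w))"

lemma mem_S3_iff: "p \<in> S3 \<longleftrightarrow> (cmod (fst p))\<^sup>2 + (cmod (snd p))\<^sup>2 = 1"
  by (cases p) (simp add: norm_Pair)

lemma linear_flow_0 [simp]: "linear_flow a 0 p = p"
  by (simp add: linear_flow_def)

lemma linear_flow_in_S3_iff:
  "linear_flow a w p \<in> S3 \<longleftrightarrow>
     (cmod (fst p) * exp (Re (a * w)))\<^sup>2 + (cmod (snd p) * exp (Re ((1 - a) * w)))\<^sup>2 = 1"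
  unfolding mem_S3_iff linear_flow_def by (simp add: norm_mult)

text \<open>The coefficient \<open>l\<close> is written as a continuous function of the point and the vector. It is the
  Hermitian product of \<open>p\<close> with \<open>(v\<^sub>1 / a, v\<^sub>2 / (1 - a))\<close>: if \<open>v = l (a z\<^sub>1, (1 - a) z\<^sub>2)\<close>, this
  product is \<open>l |p|\<^sup>2 = l\<close>.\<close>
lemma omega_kernel:
  assumes a: "a \<noteq> 0" "a \<noteq> 1" and p: "p \<in> S3" and w: "omega a p v = 0"
  defines "l \<equiv> cnj (fst p) * fst v / a + cnj (snd p) * snd v / (1 - a)"
  shows "fst v = a * l * fst p" "snd v = (1 - a) * l * snd p"
proof -
  obtain z1 z2 v1 v2 where pv: "p = (z1, z2)" "v = (v1, v2)"
    by fastforce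
  have s: "z1 * cnj z1 + z2 * cnj z2 = 1"
    using p unfolding mem_S3_iff pv
    by (metis complex_norm_square fst_conv of_real_1 of_real_add snd_conv)
  have o: "a * z1 * v2 = (1 - a) * z2 * v1"
    using w by (simp add: omega_def pv)
  have a1: "1 - a \<noteq> 0" using a by simp
  have "a * l * z1 = cnj z1 * z1 * v1 + cnj z2 * (a * z1 * v2) / (1 - a)"
    using a a1 by (simp add: l_def pv field_simps)
  also have "\<dots> = (z1 * cnj z1 + z2 * cnj z2) * v1"
    unfolding o using a1 by (simp add: distrib_left mult_ac)
  finally show "fst v = a * l * fst p" by (simp add: s pv)
  have "(1 - a) * l * z2 = cnj z1 * ((1 - a) * z2 * v1) / a + cnj z2 * z2 * v2"
    using a a1 by (simp add: l_def pv field_simps)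
  also have "\<dots> = (z1 * cnj z1 + z2 * cnj z2) * v2"
    unfolding o[symmetric] using a by (simp add: distrib_left mult_ac)
  finally show "snd v = (1 - a) * l * snd p" by (simp add: s pv)
qed

lemma tangent_curve_on_deriv:
  assumes "tangent_curve_on a I \<gamma>" "t \<in> I"
  shows "(\<gamma> has_vector_derivative vector_derivative \<gamma> (at t)) (at t)"
    and "\<gamma> t \<in> S3" "\<gamma> t \<bullet> vector_derivative \<gamma> (at t) = 0"
    and "omega a (\<gamma> t) (vector_derivative \<gamma> (at t)) = 0"
proof -
  have "\<gamma> differentiable at t"
    using assms unfolding tangent_curve_on_def C1_differentiable_on_eq by blast
  then show "(\<gamma> has_vector_derivative vector_derivative \<gamma> (at t)) (at t)"
    by (simp only: vector_derivative_works)
  show "\<gamma> t \<in> S3"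
    using assms unfolding tangent_curve_on_def by blast
  have v: "vector_derivative \<gamma> (at t) \<in> foliation_dir a (\<gamma> t)"
    using assms unfolding tangent_curve_on_def by blast
  then show "\<gamma> t \<bullet> vector_derivative \<gamma> (at t) = 0"
    unfolding foliation_dir_def tangent_S3_def by blast
  show "omega a (\<gamma> t) (vector_derivative \<gamma> (at t)) = 0"
    using v unfolding foliation_dir_def mem_Collect_eq complex_eq_iff zero_complex.sel by (elim conjE, intro conjI)
qed

text \<open>The quotient of \<open>f\<close> by \<open>exp (c M)\<close> has derivative zero. No division by \<open>f\<close> occurs, so
  solutions with zeros are covered; this is what allows points of the Hopf circles and other
  points to be treated together.\<close>
lemma linear_ode_unique:
  fixes f l :: "real \<Rightarrow> complex"
  assumes f: "\<And>t. t \<in> {0..1} \<Longrightarrow> (f has_vector_derivative c * l t * f t) (at t within {0..1})"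
    and M: "\<And>t. t \<in> {0..1} \<Longrightarrow> (M has_vector_derivative l t) (at t within {0..1})"
    and M0: "M 0 = 0"
  shows "f 1 = f 0 * exp (c * M 1)"
proof -
  have "((\<lambda>t. f t * exp (- c * M t)) has_vector_derivative 0) (at t within {0..1})"
    if t: "t \<in> {0..1}" for t
  proof -
    have "((\<lambda>t. exp (- c * M t)) has_vector_derivative (- c * l t) * exp (- c * M t))
            (at t within {0..1})"
      using field_vector_diff_chain_within[of "\<lambda>t. - c * M t" "- c * l t" t "{0..1}" exp "exp (- c * M t)"]
        has_vector_derivative_mult_right[OF M[OF t], of "- c"]
      by (simp add: o_def DERIV_exp has_field_derivative_at_within)
    from has_vector_derivative_mult[OF f[OF t] this] show ?thesis
      by (simp add: algebra_simps)
  qed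
  then obtain k where k: "\<And>t. t \<in> {0..1} \<Longrightarrow> f t * exp (- c * M t) = k"
    using has_vector_derivative_zero_constant[OF convex_closed_interval, of "0::real" 1] by blast
  have "f 1 * exp (- c * M 1) = f 0"
    using k[of 0] k[of 1] M0 by simp
  then show ?thesis
    by (simp add: exp_minus field_simps)
qed

text \<open>The two coordinates satisfy linear equations with the same multiplier \<open>l\<close>, so a single complex
  time, the integral of \<open>l\<close>, serves for both.\<close>
lemma tangent_curve_endpoint:
  assumes a: "a \<noteq> 0" "a \<noteq> 1" and tc: "tangent_curve_on a {0..1} \<gamma>"
  shows "\<exists>w. \<gamma> 1 = linear_flow a w (\<gamma> 0)"
proof -
  define V where "V t = vector_derivative \<gamma> (at t)" for t
  define l where "l t = cnj (fst (\<gamma> t)) * fst (V t) / a + cnj (snd (\<gamma> t)) * snd (V t) / (1 - a)" for t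
  note d = tangent_curve_on_deriv[OF tc, folded V_def]
  have cV: "continuous_on {0..1} V"
    using tc by (simp add: tangent_curve_on_def C1_differentiable_on_eq V_def)
  have c\<gamma>: "continuous_on {0..1} \<gamma>"
    using d(1) by (meson continuous_at_imp_continuous_on has_vector_derivative_continuous)
  have "continuous_on {0..1} l"
    unfolding l_def using a by (intro continuous_intros c\<gamma> cV) auto
  then have M: "((\<lambda>t. integral {0..t} l) has_vector_derivative l t) (at t within {0..1})"
    if "t \<in> {0..1}" for t
    using that by (intro integral_has_vector_derivative) auto
  have f: "((\<lambda>t. fst (\<gamma> t)) has_vector_derivative a * l t * fst (\<gamma> t)) (at t within {0..1})"
    and s: "((\<lambda>t. snd (\<gamma> t)) has_vector_derivative (1 - a) * l t * snd (\<gamma> t)) (at t within {0..1})"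
    if "t \<in> {0..1}" for t
    using bounded_linear.has_vector_derivative[OF bounded_linear_fst has_vector_derivative_at_within[OF d(1)[OF that]]]
      bounded_linear.has_vector_derivative[OF bounded_linear_snd has_vector_derivative_at_within[OF d(1)[OF that]]]
      omega_kernel[OF a d(2)[OF that] d(4)[OF that]]
    by (simp_all add: l_def)
  have "fst (\<gamma> 1) = fst (\<gamma> 0) * exp (a * integral {0..1} l)"
    by (rule linear_ode_unique[where l = l and M = "\<lambda>t. integral {0..t} l"]) (simp_all add: f M)
  moreover have "snd (\<gamma> 1) = snd (\<gamma> 0) * exp ((1 - a) * integral {0..1} l)"
    by (rule linear_ode_unique[where l = l and M = "\<lambda>t. integral {0..t} l"]) (simp_all add: s M)
  ultimately have "\<gamma> 1 = linear_flow a (integral {0..1} l) (\<gamma> 0)"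
    unfolding linear_flow_def by (simp add: prod_eq_iff)
  then show ?thesis ..
qed

lemma has_vector_derivative_linear_flow:
  assumes "(L has_vector_derivative l) (at t)"
  shows "((\<lambda>t. linear_flow a (L t) p) has_vector_derivative
     (a * l * fst (linear_flow a (L t) p), (1 - a) * l * snd (linear_flow a (L t) p))) (at t)"
proof -
  have *: "((\<lambda>t. z * exp (c * L t)) has_vector_derivative c * l * (z * exp (c * L t))) (at t)" for z c
  proof -
    have "((\<lambda>t. exp (c * L t)) has_vector_derivative (c * l) * exp (c * L t)) (at t)"
      using field_vector_diff_chain_at[of "\<lambda>t. c * L t" "c * l" t exp "exp (c * L t)"]
        has_vector_derivative_mult_right[OF assms, of c]
      by (simp add: o_def DERIV_exp)
    from has_vector_derivative_mult_right[OF this, of z] show ?thesis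
      by (simp add: algebra_simps)
  qed
  show ?thesis
    unfolding linear_flow_def by (auto intro!: has_vector_derivative_Pair *)
qed

text \<open>Velocities along the flow are in the kernel of \<open>\<omega>\<^sup>a\<close> automatically; they are tangent to the sphere
  because the norm is constant along the curve.\<close>
lemma tangent_curve_linear_flow:
  assumes L: "\<And>t. (L has_vector_derivative l t) (at t)" and cl: "continuous_on UNIV l"
    and S: "\<And>t. linear_flow a (L t) p \<in> S3"
  shows "tangent_curve_on a UNIV (\<lambda>t. linear_flow a (L t) p)"
proof -
  let ?g = "\<lambda>t. linear_flow a (L t) p"
  define V where "V t = (a * l t * fst (?g t), (1 - a) * l t * snd (?g t))" for t
  have V: "(?g has_vector_derivative V t) (at t)" for t
    unfolding V_def by (rule has_vector_derivative_linear_flow[OF L])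
  have cg: "continuous_on UNIV ?g"
    using V by (meson continuous_at_imp_continuous_on has_vector_derivative_continuous)
  have "continuous_on UNIV V"
    unfolding V_def by (intro continuous_intros cg cl)
  then have C1: "?g C1_differentiable_on UNIV"
    unfolding C1_differentiable_on_def using V by blast
  have "?g t \<bullet> V t = 0" for t
  proof -
    have "((\<lambda>t. ?g t \<bullet> ?g t) has_vector_derivative (?g t \<bullet> V t + V t \<bullet> ?g t)) (at t)"
      using bounded_bilinear.has_vector_derivative[OF bounded_bilinear_inner V V] .
    moreover have "(\<lambda>t. ?g t \<bullet> ?g t) = (\<lambda>t. 1)"
      using S by (auto simp: dot_square_norm)
    ultimately have "?g t \<bullet> V t + V t \<bullet> ?g t = 0"
      by (metis has_vector_derivative_const vector_derivative_at)
    then show ?thesis by (simp add: inner_commute)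
  qed
  moreover have "omega a (?g t) (V t) = 0" for t
    by (simp add: omega_def V_def)
  ultimately show ?thesis
    unfolding tangent_curve_on_def
    using C1 S by (simp add: vector_derivative_at[OF V] foliation_dir_def tangent_S3_def)
qed

lemma tangent_curve_on_subset:
  "tangent_curve_on a I \<gamma> \<Longrightarrow> J \<subseteq> I \<Longrightarrow> tangent_curve_on a J \<gamma>"
  unfolding tangent_curve_on_def by (blast intro: C1_differentiable_on_subset)

text \<open>This reduces the description of a leaf to solving the equation of the sphere for the complex
  time. To join \<open>p\<close> to another point of the curve, run through the parameter interval between the time
  \<open>0\<close>, which belongs to \<open>p\<close>, and the time of that point.\<close>
lemma orbit_param_linear_flow:
  assumes a: "a \<noteq> 0" "a \<noteq> 1" and p: "p \<in> S3"
    and L: "\<And>t. (L has_vector_derivative l t) (at t)" and cl: "continuous_on UNIV l"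
    and l0: "\<And>t. l t \<noteq> 0"
    and range: "range L = {w. linear_flow a w p \<in> S3}"
  shows "orbit_param a (leaf a p) (\<lambda>t. linear_flow a (L t) p)"
proof -
  have S: "linear_flow a (L t) p \<in> S3" for t
    using range by blast
  have nz: "vector_derivative (\<lambda>t. linear_flow a (L t) p) (at t) \<noteq> 0" for t
    using l0[of t] a S[of t, unfolded mem_S3_iff]
    unfolding vector_derivative_at[OF has_vector_derivative_linear_flow[OF L]] zero_prod_def
    by auto
  have "q \<in> range (\<lambda>t. linear_flow a (L t) p)" if q: "q \<in> leaf a p" for q
  proof -
    from q obtain \<gamma> where \<gamma>: "tangent_curve_on a {0..1} \<gamma>" "\<gamma> 0 = p" "\<gamma> 1 = q"
      by (auto simp: leaf_def)
    obtain w where "q = linear_flow a w p"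
      using tangent_curve_endpoint[OF a \<gamma>(1)] \<gamma> by auto
    moreover have "q \<in> S3"
      using tangent_curve_on_deriv(2)[OF \<gamma>(1), of 1] \<gamma>(3) by simp
    ultimately have "w \<in> range L"
      using range by auto
    then show ?thesis
      using \<open>q = linear_flow a w p\<close> by auto
  qed
  moreover have "linear_flow a (L t1) p \<in> leaf a p" for t1
  proof -
    have "0 \<in> range L"
      using range p by simp
    then obtain t0 where t0: "L t0 = 0" by (metis rangeE)
    define \<phi> where "\<phi> t = t0 + t * (t1 - t0)" for t :: real
    have "tangent_curve_on a UNIV (\<lambda>t. linear_flow a ((L \<circ> \<phi>) t) p)"
    proof (rule tangent_curve_linear_flow)
      show "(L \<circ> \<phi> has_vector_derivative (t1 - t0) *\<^sub>R l (\<phi> t)) (at t)" for t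
      proof (rule vector_diff_chain_at[OF _ L])
        show "(\<phi> has_vector_derivative t1 - t0) (at t)"
          unfolding \<phi>_def by (auto intro!: derivative_eq_intros)
      qed
      show "continuous_on UNIV (\<lambda>t. (t1 - t0) *\<^sub>R l (\<phi> t))"
        unfolding \<phi>_def
        by (intro continuous_intros continuous_on_compose2[OF cl]) auto
      show "linear_flow a ((L \<circ> \<phi>) t) p \<in> S3" for t
        unfolding o_def by (rule S)
    qed
    then have "tangent_curve_on a {0..1} (\<lambda>t. linear_flow a ((L \<circ> \<phi>) t) p)"
      by (rule tangent_curve_on_subset) simp
    moreover have "linear_flow a ((L \<circ> \<phi>) 0) p = p" "(L \<circ> \<phi>) 1 = L t1"
      by (simp_all add: \<phi>_def t0)
    ultimately show ?thesis
      unfolding leaf_def mem_Collect_eq by metis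
  qed
  ultimately have "range (\<lambda>t. linear_flow a (L t) p) = leaf a p"
    by blast
  then show ?thesis
    using tangent_curve_linear_flow[OF L cl S] nz by (simp add: orbit_param_def)
qed

lemma leaf_eq:
  assumes "orbit_param a (leaf a p) (\<lambda>t. linear_flow a (L t) p)"
    and "range L = {w. linear_flow a w p \<in> S3}"
  shows "leaf a p = {linear_flow a w p | w. linear_flow a w p \<in> S3}"
proof -
  have "leaf a p = range (\<lambda>t. linear_flow a (L t) p)"
    using assms(1) by (simp add: orbit_param_def)
  also have "\<dots> = (\<lambda>w. linear_flow a w p) ` range L"
    by (simp add: image_image)
  finally show ?thesis
    unfolding assms(2) by auto
qed

section \<open>The Hopf circles\<close>

lemma range_rotation: "cmod z = 1 \<Longrightarrow> range (\<lambda>t. z * cis t) = sphere 0 1"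
proof safe
  fix u :: complex
  assume z: "cmod z = 1" and u: "u \<in> sphere 0 1"
  then have nz: "z \<noteq> 0" "u \<noteq> 0" by auto
  have "cmod (u / z) = 1"
    using z u by (simp add: norm_divide)
  with nz have "cis (Arg (u / z)) = u / z"
    by (simp add: cis_Arg sgn_eq)
  with nz have "u = z * cis (Arg (u / z))"
    by simp
  then show "u \<in> range (\<lambda>t. z * cis t)" by blast
qed (auto simp: norm_mult)

lemma range_imaginary_line:
  assumes "a \<noteq> 0"
  shows "range (\<lambda>t. \<i> * of_real t / a) = {w. Re (a * w) = 0}"
proof safe
  fix w assume "Re (a * w) = 0"
  then have "a * w = \<i> * of_real (Im (a * w))"
    by (simp add: complex_eq_iff)
  then have "w = \<i> * of_real (Im (a * w)) / a"
    using assms by (metis nonzero_mult_div_cancel_left)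
  then show "w \<in> range (\<lambda>t. \<i> * of_real t / a)" by blast
next
  fix t
  have "a * (\<i> * of_real t / a) = \<i> * of_real t"
    using assms by simp
  then show "Re (a * (\<i> * of_real t / a)) = 0"
    by (metis Re_i_times Im_complex_of_real neg_0_equal_iff_equal)
qed

text \<open>The common form of the Hopf circles (\<open>c = a\<close> or \<open>c = 1 - a\<close>) and of all leaves for real \<open>a\<close>
  (\<open>c = 1\<close>): the admissible complex times form a real line through \<open>0\<close>.\<close>
lemma orbit_param_imaginary_line:
  assumes a: "a \<noteq> 0" "a \<noteq> 1" and p: "p \<in> S3" and c: "c \<noteq> 0"
    and S: "\<And>w. linear_flow a w p \<in> S3 \<longleftrightarrow> Re (c * w) = 0"
  shows "orbit_param a (leaf a p) (\<lambda>t. linear_flow a (\<i> * of_real t / c) p)"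
proof (rule orbit_param_linear_flow[OF a p])
  show "((\<lambda>t. \<i> * of_real t / c) has_vector_derivative \<i> / c) (at t)" for t
    using c by (auto intro!: derivative_eq_intros simp: has_vector_derivative_def scaleR_conv_of_real)
  show "range (\<lambda>t. \<i> * of_real t / c) = {w. linear_flow a w p \<in> S3}"
    using range_imaginary_line[OF c] S by simp
  show "\<i> / c \<noteq> 0"
    using c by simp
qed simp

lemma orbit_param_hopf1:
  assumes a: "a \<noteq> 0" "a \<noteq> 1" and p: "p \<in> S3" "snd p = 0"
  shows "leaf a p = hopf1" "orbit_param a hopf1 (\<lambda>t. (fst p * cis t, 0))"
proof -
  have n: "cmod (fst p) = 1"
    using p unfolding mem_S3_iff by (simp add: abs_square_eq_1)
  have "linear_flow a w p \<in> S3 \<longleftrightarrow> Re (a * w) = 0" for w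
    unfolding linear_flow_in_S3_iff using n p(2) by (simp add: abs_square_eq_1 del: times_complex.sel)
  from orbit_param_imaginary_line[OF a p(1) a(1) this]
  have *: "orbit_param a (leaf a p) (\<lambda>t. (fst p * cis t, 0))"
    using a p(2) by (simp add: linear_flow_def cis_conv_exp)
  then have "leaf a p = range (\<lambda>t. (fst p * cis t, 0))"
    by (simp add: orbit_param_def)
  also have "\<dots> = range (\<lambda>t. fst p * cis t) \<times> {0}"
    by auto
  finally show "leaf a p = hopf1"
    by (simp add: range_rotation[OF n] hopf1_def)
  with * show "orbit_param a hopf1 (\<lambda>t. (fst p * cis t, 0))" by simp
qed

lemma orbit_param_hopf2:
  assumes a: "a \<noteq> 0" "a \<noteq> 1" and p: "p \<in> S3" "fst p = 0"
  shows "leaf a p = hopf2" "orbit_param a hopf2 (\<lambda>t. (0, snd p * cis t))"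
proof -
  have n: "cmod (snd p) = 1"
    using p unfolding mem_S3_iff by (simp add: abs_square_eq_1)
  have "linear_flow a w p \<in> S3 \<longleftrightarrow> Re ((1 - a) * w) = 0" for w
    unfolding linear_flow_in_S3_iff using n p(2) by (simp add: abs_square_eq_1 del: times_complex.sel)
  from orbit_param_imaginary_line[OF a p(1) _ this]
  have *: "orbit_param a (leaf a p) (\<lambda>t. (0, snd p * cis t))"
    using a p(2) by (simp add: linear_flow_def cis_conv_exp)
  then have "leaf a p = range (\<lambda>t. (0, snd p * cis t))"
    by (simp add: orbit_param_def)
  also have "\<dots> = {0} \<times> range (\<lambda>t. snd p * cis t)"
    by auto
  finally show "leaf a p = hopf2"
    by (simp add: range_rotation[OF n] hopf2_def)
  with * show "orbit_param a hopf2 (\<lambda>t. (0, snd p * cis t))" by simp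
qed

lemma closed_leaf_hopf1:
  assumes a: "a \<noteq> 0" "a \<noteq> 1"
  shows "closed_leaf a hopf1"
proof -
  have p: "(1, 0) \<in> S3" by (simp add: mem_S3_iff)
  have "hopf1 \<in> leaves a"
    unfolding leaves_def using orbit_param_hopf1(1)[OF a p] p by (metis imageI snd_conv)
  moreover have "cis (t + 2 * pi) = cis t" for t
    by (simp flip: cis_mult)
  ultimately show ?thesis
    unfolding closed_leaf_def using orbit_param_hopf1(2)[OF a p]
    by (intro conjI exI[of _ "\<lambda>t. (1 * cis t, 0)"] exI[of _ "2 * pi"]) auto
qed

lemma closed_leaf_hopf2:
  assumes a: "a \<noteq> 0" "a \<noteq> 1"
  shows "closed_leaf a hopf2"
proof -
  have p: "(0, 1) \<in> S3" by (simp add: mem_S3_iff)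
  have "hopf2 \<in> leaves a"
    unfolding leaves_def using orbit_param_hopf2(1)[OF a p] p by (metis imageI fst_conv)
  moreover have "cis (t + 2 * pi) = cis t" for t
    by (simp flip: cis_mult)
  ultimately show ?thesis
    unfolding closed_leaf_def using orbit_param_hopf2(2)[OF a p]
    by (intro conjI exI[of _ "\<lambda>t. (0, 1 * cis t)"] exI[of _ "2 * pi"]) auto
qed

lemma non_hopf_leaf:
  assumes a: "a \<noteq> 0" "a \<noteq> 1" and L: "L \<in> leaves a - {hopf1, hopf2}"
  obtains p where "p \<in> S3" "fst p \<noteq> 0" "snd p \<noteq> 0" "L = leaf a p"
  using L orbit_param_hopf1(1)[OF a] orbit_param_hopf2(1)[OF a] unfolding leaves_def by blast

section \<open>Non-real parameters: parametrisation of the leaves\<close>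

text \<open>This is where \<open>a \<notin> \<real>\<close> enters: \<open>a\<close> and \<open>1 - a\<close> are then linearly independent over the reals, so
  that the logarithmic growth rates of \<open>|z\<^sub>1|\<close> and \<open>|z\<^sub>2|\<close> can be prescribed independently.\<close>
lemma Re_coordinates_iff:
  assumes "Im a \<noteq> 0"
  shows "Re (a * w) = A \<and> Re ((1 - a) * w) = B \<longleftrightarrow>
    w = \<i> / of_real (Im a) * (of_real B * cnj a - of_real A * (1 - cnj a))" (is "?l \<longleftrightarrow> w = ?w")
proof
  assume ?l
  then have "Re w = A + B" "Im a * Im w = Re a * Re w - A"
    by (auto simp: algebra_simps)
  then show "w = ?w"
    using assms by (simp add: complex_eq_iff field_simps)
next
  assume w: "w = ?w"
  have "Re w = A + B" "Im w = (Re a * (A + B) - A) / Im a"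
    using assms by (simp_all add: w field_simps)
  then show ?l
    using assms by (simp add: field_simps)
qed

text \<open>The leaf is parametrised by \<open>s = ln |z\<^sub>2| - ln |z\<^sub>1|\<close>, which runs over the whole real line and
  determines the moduli on the sphere: \<open>|z\<^sub>1| = exp (P s)\<close> and \<open>|z\<^sub>2| = exp (s + P s)\<close> with
  \<open>P s = - ln (1 + exp (2 s)) / 2\<close>. The logarithms of the ratios of these moduli to
  those at \<open>p\<close> are \<open>Re (a w)\<close> and \<open>Re ((1 - a) w)\<close>, and they determine the complex time \<open>w\<close>.\<close>
lemma orbit_param_nonreal:
  assumes a: "a \<notin> \<real>" and p: "p \<in> S3" "fst p \<noteq> 0" "snd p \<noteq> 0"
  shows "\<exists>L. orbit_param a (leaf a p) (\<lambda>t. linear_flow a (L t) p) \<and>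
    range L = {w. linear_flow a w p \<in> S3}"
proof -
  have Ima: "Im a \<noteq> 0"
    using a by (simp add: complex_is_Real_iff)
  define P where "P s = - ln (1 + exp (2 * s)) / 2" for s :: real
  define A where "A s = P s - ln (cmod (fst p))" for s
  define B where "B s = s + P s - ln (cmod (snd p))" for s
  define L where "L s = \<i> / of_real (Im a) * (of_real (B s) * cnj a - of_real (A s) * (1 - cnj a))" for s
  define A' where "A' s = - exp (2 * s) / (1 + exp (2 * s))" for s :: real
  define l where "l s = \<i> / of_real (Im a) * (of_real (1 + A' s) * cnj a - of_real (A' s) * (1 - cnj a))" for s
  have pos: "1 + exp (2 * s) > 0" for s :: real
    by (simp add: add_pos_pos)
  have P: "(P has_real_derivative A' s) (at s)" for s
    unfolding P_def A'_def using pos[of s]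
    by (auto intro!: derivative_eq_intros simp: field_simps)
  have LA: "Re (a * L s) = A s" "Re ((1 - a) * L s) = B s" for s
    using Re_coordinates_iff[OF Ima, of "L s" "A s" "B s"] L_def by auto
  have dL: "(L has_vector_derivative l s) (at s)" for s
  proof -
    have "((\<lambda>s. of_real (A s)) has_vector_derivative complex_of_real (A' s)) (at s)"
      "((\<lambda>s. of_real (B s)) has_vector_derivative complex_of_real (1 + A' s)) (at s)"
      unfolding A_def B_def
      by (intro has_vector_derivative_of_real, auto intro!: derivative_eq_intros P)+
    then show ?thesis
      unfolding L_def l_def
      by (intro has_vector_derivative_mult_right has_vector_derivative_diff
          has_vector_derivative_mult_left)
  qed
  have cl: "continuous_on UNIV l"
    unfolding l_def A'_def using pos by (intro continuous_intros) (auto simp: less_imp_neq[symmetric] Ima)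
  have nz: "l s \<noteq> 0" for s
  proof -
    \<comment> \<open>Along the curve \<open>|z\<^sub>1|\<close> is strictly decreasing in \<open>s\<close>.\<close>
    have "Re (a * l s) = A' s"
      using Re_coordinates_iff[OF Ima, of "l s" "A' s" "1 + A' s"] l_def by auto
    then show ?thesis
      using pos[of s] by (auto simp: A'_def)
  qed
  have sph: "linear_flow a (L s) p \<in> S3" for s
  proof -
    have e: "exp (P s) ^ 2 = 1 / (1 + exp (2 * s))"
    proof -
      have "exp (P s) ^ 2 = exp (- ln (1 + exp (2 * s)))"
        unfolding exp_double[symmetric] by (simp add: P_def)
      then show ?thesis
        using pos[of s] by (simp add: exp_minus inverse_eq_divide)
    qed
    have "cmod (fst p) * exp (A s) = exp (P s)" "cmod (snd p) * exp (B s) = exp s * exp (P s)"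
      using p by (simp_all add: A_def B_def exp_diff exp_add)
    then show ?thesis
      unfolding linear_flow_in_S3_iff LA
      using pos[of s] by (simp add: power_mult_distrib e exp_double add_divide_distrib[symmetric])
  qed
  have surj: "w \<in> range L" if w: "linear_flow a w p \<in> S3" for w
  proof -
    define x where "x = cmod (fst p) * exp (Re (a * w))"
    define y where "y = cmod (snd p) * exp (Re ((1 - a) * w))"
    have xy: "x > 0" "y > 0" "x\<^sup>2 + y\<^sup>2 = 1"
      using w p unfolding linear_flow_in_S3_iff x_def y_def by auto
    define s where "s = ln y - ln x"
    have "exp s = y / x"
      using xy(1,2) by (simp add: s_def exp_diff)
    then have "exp (2 * s) = (y / x)\<^sup>2"
      by (simp only: exp_double)
    then have "1 + exp (2 * s) = (x\<^sup>2 + y\<^sup>2) / x\<^sup>2"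
      using xy(1) by (simp add: power_divide add_divide_distrib)
    then have "1 + exp (2 * s) = 1 / x\<^sup>2"
      by (simp only: xy(3))
    then have "P s = ln x"
      using xy by (simp add: P_def ln_div ln_realpow)
    then have "A s = Re (a * w)" "B s = Re ((1 - a) * w)"
      using p by (simp_all add: A_def B_def s_def x_def y_def ln_mult del: times_complex.sel)
    then have "w = L s"
      using Re_coordinates_iff[OF Ima, of w "A s" "B s"] by (simp add: L_def)
    then show ?thesis by blast
  qed
  have range: "range L = {w. linear_flow a w p \<in> S3}"
    using sph surj by blast
  have "a \<noteq> 0" "a \<noteq> 1"
    using a by auto
  from orbit_param_linear_flow[OF this p(1) dL cl nz range] range show ?thesis by blast
qed

lemma range_cmod_nonreal_leaf:
  assumes a: "a \<notin> \<real>" and p: "p \<in> S3" "fst p \<noteq> 0" "snd p \<noteq> 0"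
  shows "(\<lambda>z. (cmod (fst z))\<^sup>2) ` leaf a p = {0<..<1}"
proof -
  have Ima: "Im a \<noteq> 0"
    using a by (simp add: complex_is_Real_iff)
  have L: "leaf a p = {linear_flow a w p | w. linear_flow a w p \<in> S3}"
    using orbit_param_nonreal[OF assms] leaf_eq by blast
  show ?thesis
  proof (intro equalityI subsetI)
    fix q assume "q \<in> (\<lambda>z. (cmod (fst z))\<^sup>2) ` leaf a p"
    then obtain w where w: "linear_flow a w p \<in> S3" "q = (cmod (fst (linear_flow a w p)))\<^sup>2"
      unfolding L by blast
    have "fst (linear_flow a w p) \<noteq> 0" "snd (linear_flow a w p) \<noteq> 0"
      using p by (simp_all add: linear_flow_def)
    then have "0 < (cmod (fst (linear_flow a w p)))\<^sup>2" "0 < (cmod (snd (linear_flow a w p)))\<^sup>2"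
      by simp_all
    then show "q \<in> {0<..<1}"
      using w(1) unfolding mem_S3_iff w(2) greaterThanLessThan_iff by linarith
  next
    fix q :: real assume q: "q \<in> {0<..<1}"
    define A where "A = ln (sqrt q / cmod (fst p))"
    define B where "B = ln (sqrt (1 - q) / cmod (snd p))"
    obtain w where w: "Re (a * w) = A" "Re ((1 - a) * w) = B"
      using Re_coordinates_iff[OF Ima, of _ A B] by blast
    have "cmod (fst p) * exp A = sqrt q" "cmod (snd p) * exp B = sqrt (1 - q)"
      using p q by (simp_all add: A_def B_def)
    then have "linear_flow a w p \<in> S3" "(cmod (fst (linear_flow a w p)))\<^sup>2 = q"
      using q unfolding linear_flow_in_S3_iff w
      by (simp_all add: linear_flow_def norm_mult w del: times_complex.sel)
    then show "q \<in> (\<lambda>z. (cmod (fst z))\<^sup>2) ` leaf a p"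
      unfolding L by blast
  qed
qed

section \<open>Non-real parameters: asymptotics\<close>

lemma mono_limits:
  fixes f :: "real \<Rightarrow> real"
  assumes m: "mono f" and r: "range f = {0<..<1}"
  shows "(f \<longlongrightarrow> 0) at_bot" "(f \<longlongrightarrow> 1) at_top"
proof -
  have b: "0 < f t" "f t < 1" for t
    using r by (metis greaterThanLessThan_iff rangeI)+
  show "(f \<longlongrightarrow> 1) at_top"
  proof (rule order_tendstoI)
    fix y :: real assume "y < 1"
    then have "(max y 0 + 1) / 2 \<in> range f"
      unfolding r by auto
    then obtain t where t: "f t = (max y 0 + 1) / 2" by force
    have "y < f t" using t \<open>y < 1\<close> by auto
    then have "y < f u" if "u \<ge> t" for u
      using monoD[OF m that] by simp
    then show "eventually (\<lambda>u. y < f u) at_top"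
      by (meson eventually_at_top_linorderI)
  qed (use b in \<open>auto intro: always_eventually less_trans\<close>)
  show "(f \<longlongrightarrow> 0) at_bot"
  proof (rule order_tendstoI)
    fix y :: real assume "0 < y"
    then have "min y 1 / 2 \<in> range f"
      unfolding r by auto
    then obtain t where t: "f t = min y 1 / 2" by force
    have "f t < y" using t \<open>0 < y\<close> by auto
    then have "f u < y" if "u \<le> t" for u
      using monoD[OF m that] by simp
    then show "eventually (\<lambda>u. f u < y) at_bot"
      by (meson eventually_at_bot_linorderI)
  qed (use b in \<open>auto intro: always_eventually less_trans\<close>)
qed

lemma injective_limits:
  fixes f :: "real \<Rightarrow> real"
  assumes c: "continuous_on UNIV f" and i: "inj f" and r: "range f = {0<..<1}"
  shows "(f \<longlongrightarrow> 0) at_bot \<and> (f \<longlongrightarrow> 1) at_top \<or> (f \<longlongrightarrow> 1) at_bot \<and> (f \<longlongrightarrow> 0) at_top"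
proof -
  have "strict_mono f \<or> strict_antimono_on UNIV f"
    using injective_eq_monotone_map[OF is_interval_univ c] i by simp
  then show ?thesis
  proof
    assume "strict_mono f"
    then show ?thesis
      using mono_limits[OF strict_mono_mono r] by blast
  next
    assume s: "strict_antimono_on UNIV f"
    have "mono (\<lambda>t. 1 - f t)"
      using s by (intro monoI) (metis diff_left_mono le_less monotone_on_def UNIV_I)
    moreover have "range (\<lambda>t. 1 - f t) = {0<..<1}"
    proof -
      have "range (\<lambda>t. 1 - f t) = (-) 1 ` {0<..<1}"
        unfolding r[symmetric] by (simp add: image_image)
      also have "\<dots> = {0<..<1::real}"
        by (auto intro!: image_eqI[of _ _ "1 - _"])
      finally show ?thesis .
    qed
    ultimately have l: "((\<lambda>t. 1 - f t) \<longlongrightarrow> 0) at_bot" "((\<lambda>t. 1 - f t) \<longlongrightarrow> 1) at_top"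
      using mono_limits by blast+
    show ?thesis
      using tendsto_diff[OF tendsto_const[of "1::real"] l(1)] tendsto_diff[OF tendsto_const[of "1::real"] l(2)]
      by (simp only: diff_diff_eq2 add_diff_cancel_left' diff_self diff_0_right simp_thms)
  qed
qed

text \<open>Compare with the radial projection \<open>(z\<^sub>1 / |z\<^sub>1|, 0)\<close>, using \<open>1 - |z\<^sub>1| \<le> 1 - |z\<^sub>1|\<^sup>2\<close>.\<close>
lemma infdist_hopf1_le:
  assumes z: "z \<in> S3" "fst z \<noteq> 0"
  defines "q \<equiv> (cmod (fst z))\<^sup>2"
  shows "infdist z hopf1 \<le> (1 - q) + sqrt (1 - q)"
proof -
  define u where "u = sgn (fst z)"
  have u: "cmod u = 1" "fst z = of_real (cmod (fst z)) * u"
    using z(2) by (simp add: u_def norm_sgn, simp add: u_def sgn_eq)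
  have s: "cmod (snd z) = sqrt (1 - q)"
    using z(1) unfolding mem_S3_iff q_def by (metis add_diff_cancel_left' norm_ge_zero real_sqrt_unique)
  have le: "cmod (fst z) \<le> 1"
    using z(1) norm_fst_le[of "fst z" "snd z"] by simp
  have "fst z - u = of_real (cmod (fst z) - 1) * u"
    by (subst u(2)) (simp add: algebra_simps)
  then have d: "dist (fst z) u = 1 - cmod (fst z)"
    using le unfolding dist_norm by (simp only: norm_mult norm_of_real u(1), simp)
  have "infdist z hopf1 \<le> dist z (u, 0)"
    using u(1) by (intro infdist_le) (simp add: hopf1_def)
  also have "\<dots> \<le> dist (fst z) u + dist (snd z) 0"
    unfolding dist_prod_def by (simp add: sqrt_sum_squares_le_sum)
  also have "\<dots> = 1 - cmod (fst z) + sqrt (1 - q)"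
    using s d by simp
  also have "\<dots> \<le> (1 - q) + sqrt (1 - q)"
    using le by (simp add: q_def power2_eq_square mult_left_le)
  finally show ?thesis .
qed

lemma infdist_hopf2_le:
  assumes z: "z \<in> S3" "snd z \<noteq> 0"
  defines "q \<equiv> (cmod (fst z))\<^sup>2"
  shows "infdist z hopf2 \<le> q + sqrt q"
proof -
  define z' where "z' = (snd z, fst z)"
  have z': "z' \<in> S3" "fst z' \<noteq> 0"
    using z unfolding z'_def mem_S3_iff by simp_all
  have "infdist z hopf2 = infdist z' hopf1"
  proof -
    have swap: "hopf2 = prod.swap ` hopf1"
      by (auto simp: hopf1_def hopf2_def)
    have "dist z (prod.swap y) = dist z' y" for y
      by (simp add: dist_prod_def z'_def add.commute)
    then have "dist z ` hopf2 = dist z' ` hopf1"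
      unfolding swap image_image by (rule image_cong[OF refl])
    moreover have "hopf1 \<noteq> {}" "hopf2 \<noteq> {}"
      by (simp_all add: hopf1_def hopf2_def)
    ultimately show ?thesis
      by (simp add: infdist_def)
  qed
  moreover have "1 - (cmod (fst z'))\<^sup>2 = q"
    using z(1) unfolding mem_S3_iff z'_def q_def by simp
  ultimately show ?thesis
    using infdist_hopf1_le[OF z'] by simp
qed

lemma asymptotic_to_hopf:
  assumes S: "\<And>t. \<gamma> t \<in> S3"
  shows "((\<lambda>t. (cmod (fst (\<gamma> t)))\<^sup>2) \<longlongrightarrow> 1) F \<Longrightarrow> (\<And>t. fst (\<gamma> t) \<noteq> 0) \<Longrightarrow> asymptotic_to \<gamma> hopf1 F"
    and "((\<lambda>t. (cmod (fst (\<gamma> t)))\<^sup>2) \<longlongrightarrow> 0) F \<Longrightarrow> (\<And>t. snd (\<gamma> t) \<noteq> 0) \<Longrightarrow> asymptotic_to \<gamma> hopf2 F"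
proof -
  define q where "q t = (cmod (fst (\<gamma> t)))\<^sup>2" for t
  { assume q: "((\<lambda>t. (cmod (fst (\<gamma> t)))\<^sup>2) \<longlongrightarrow> 1) F" and nz: "\<And>t. fst (\<gamma> t) \<noteq> 0"
    have "((\<lambda>t. (1 - q t) + sqrt (1 - q t)) \<longlongrightarrow> (1 - 1) + sqrt (1 - 1)) F"
      unfolding q_def by (intro tendsto_intros q)
    then have lim: "((\<lambda>t. (1 - q t) + sqrt (1 - q t)) \<longlongrightarrow> 0) F" by simp
    show "asymptotic_to \<gamma> hopf1 F"
      unfolding asymptotic_to_def
      by (rule tendsto_sandwich[OF _ _ tendsto_const lim])
        (simp_all add: infdist_nonneg infdist_hopf1_le[OF S nz, folded q_def]) }
  { assume q: "((\<lambda>t. (cmod (fst (\<gamma> t)))\<^sup>2) \<longlongrightarrow> 0) F" and nz: "\<And>t. snd (\<gamma> t) \<noteq> 0"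
    have "((\<lambda>t. q t + sqrt (q t)) \<longlongrightarrow> 0 + sqrt 0) F"
      unfolding q_def by (intro tendsto_intros q)
    then have lim: "((\<lambda>t. q t + sqrt (q t)) \<longlongrightarrow> 0) F" by simp
    show "asymptotic_to \<gamma> hopf2 F"
      unfolding asymptotic_to_def
      by (rule tendsto_sandwich[OF _ _ tendsto_const lim])
        (simp_all add: infdist_nonneg infdist_hopf2_le[OF S nz, folded q_def]) }
qed

text \<open>On the sphere \<open>|z\<^sub>1|\<close> and \<open>|z\<^sub>2|\<close> are stationary together. For \<open>v = l (a z\<^sub>1, (1 - a) z\<^sub>2)\<close>
  this makes \<open>Re (a l)\<close> and \<open>Re ((1 - a) l)\<close> vanish, and these are real coordinates of \<open>l\<close>.
  Off the Hopf circles, \<open>|z\<^sub>1|\<^sup>2\<close> therefore has no critical point along a leaf.\<close>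
lemma tangent_vector_zero:
  assumes a: "a \<notin> \<real>" and z: "z \<in> S3" "fst z \<noteq> 0" "snd z \<noteq> 0"
    and v: "omega a z v = 0" "z \<bullet> v = 0" and r: "fst z \<bullet> fst v = 0"
  shows "v = 0"
proof -
  have a01: "a \<noteq> 0" "a \<noteq> 1" using a by auto
  obtain l where l: "fst v = a * l * fst z" "snd v = (1 - a) * l * snd z"
    using omega_kernel[OF a01 z(1) v(1)] by blast
  have inner: "w \<bullet> (c * w) = (cmod w)\<^sup>2 * Re c" for w c :: complex
    unfolding inner_complex_def cmod_power2 by (simp add: algebra_simps power2_eq_square)
  have "Re (a * l) = 0"
    using r z(2) unfolding l inner by simp
  moreover have "snd z \<bullet> snd v = 0"
    using v(2) r by (simp add: inner_prod_def)
  then have "Re ((1 - a) * l) = 0"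
    using z(3) unfolding l inner by simp
  ultimately have "l = 0"
    using Re_coordinates_iff[of a l 0 0] a by (simp add: complex_is_Real_iff)
  then show ?thesis
    using l by (simp add: prod_eq_iff)
qed

text \<open>By Rolle's theorem \<open>|z\<^sub>1|\<^sup>2\<close> is injective along the orbit, hence monotone. As it takes every
  value in \<open>(0, 1)\<close>, it tends to the endpoints of that interval.\<close>
lemma orbit_param_asymptotic:
  assumes a: "a \<notin> \<real>" and o: "orbit_param a L \<gamma>"
    and im: "(\<lambda>z. (cmod (fst z))\<^sup>2) ` L = {0<..<1}"
  shows "asymptotic_to \<gamma> hopf1 at_bot \<and> asymptotic_to \<gamma> hopf2 at_top \<or>
         asymptotic_to \<gamma> hopf2 at_bot \<and> asymptotic_to \<gamma> hopf1 at_top"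
proof -
  define V where "V t = vector_derivative \<gamma> (at t)" for t
  define f where "f t = (cmod (fst (\<gamma> t)))\<^sup>2" for t
  have tc: "tangent_curve_on a UNIV \<gamma>" and V0: "V t \<noteq> 0" and rg: "range \<gamma> = L" for t
    using o by (auto simp: orbit_param_def V_def)
  note d = tangent_curve_on_deriv[OF tc UNIV_I, folded V_def]
  have rf: "range f = {0<..<1}"
    unfolding im[symmetric] rg[symmetric] f_def by (simp add: image_image)
  have f01: "0 < f t" "f t < 1" for t
    using rf by (metis greaterThanLessThan_iff rangeI)+
  have nz: "fst (\<gamma> t) \<noteq> 0" "snd (\<gamma> t) \<noteq> 0" for t
    using f01[of t] d(2)[of t] unfolding mem_S3_iff f_def by auto
  have df: "(f has_real_derivative 2 * (fst (\<gamma> t) \<bullet> fst (V t))) (at t)" for t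
  proof -
    have "((\<lambda>t. fst (\<gamma> t)) has_vector_derivative fst (V t)) (at t)"
      by (rule bounded_linear.has_vector_derivative[OF bounded_linear_fst d(1)])
    from bounded_bilinear.has_vector_derivative[OF bounded_bilinear_inner this this]
    have "((\<lambda>t. fst (\<gamma> t) \<bullet> fst (\<gamma> t)) has_vector_derivative 2 * (fst (\<gamma> t) \<bullet> fst (V t))) (at t)"
      by (simp add: inner_commute)
    then show ?thesis
      unfolding f_def has_real_derivative_iff_has_vector_derivative dot_square_norm .
  qed
  have cf: "continuous_on S f" for S
    using df by (meson DERIV_isCont continuous_at_imp_continuous_on)
  have "inj f"
  proof (rule linorder_injI)
    fix s t :: real assume "s < t"
    show "f s \<noteq> f t"
    proof
      assume "f s = f t"
      then obtain u where "(f has_real_derivative 0) (at u)"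
        using Rolle[OF \<open>s < t\<close> _ cf] df real_differentiable_def by blast
      then have "fst (\<gamma> u) \<bullet> fst (V u) = 0"
        using DERIV_unique[OF df[of u]] by fastforce
      then show False
        using tangent_vector_zero[OF a d(2)[of u] nz[of u] d(4)[of u] d(3)[of u]] V0[of u] by blast
    qed
  qed
  then have "(f \<longlongrightarrow> 0) at_bot \<and> (f \<longlongrightarrow> 1) at_top \<or> (f \<longlongrightarrow> 1) at_bot \<and> (f \<longlongrightarrow> 0) at_top"
    using injective_limits[OF cf _ rf] by simp
  moreover have "(f \<longlongrightarrow> 1) F \<longrightarrow> asymptotic_to \<gamma> hopf1 F" for F
    unfolding f_def[abs_def] by (intro impI asymptotic_to_hopf(1)) (rule d(2), assumption, rule nz)
  moreover have "(f \<longlongrightarrow> 0) F \<longrightarrow> asymptotic_to \<gamma> hopf2 F" for F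
    unfolding f_def[abs_def] by (intro impI asymptotic_to_hopf(2)) (rule d(2), assumption, rule nz)
  ultimately show ?thesis
    by metis
qed

lemma leaf_asymptotic_nonreal:
  assumes a: "a \<notin> \<real>" and L: "L \<in> leaves a - {hopf1, hopf2}"
  shows "leaf_asymptotic_to_both a L hopf1 hopf2"
proof -
  have "a \<noteq> 0" "a \<noteq> 1" using a by auto
  then obtain p where p: "p \<in> S3" "fst p \<noteq> 0" "snd p \<noteq> 0" "L = leaf a p"
    using non_hopf_leaf L by blast
  show ?thesis
    unfolding leaf_asymptotic_to_both_def p(4)
    using orbit_param_nonreal[OF a p(1-3)] orbit_param_asymptotic[OF a _ range_cmod_nonreal_leaf[OF a p(1-3)]]
    by blast
qed

section \<open>Non-real parameters: closed leaves\<close>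

lemma periodic_tendsto_const:
  fixes f :: "real \<Rightarrow> real"
  assumes T: "T > 0" and per: "\<And>t. f (t + T) = f t" and F: "F = at_top \<or> F = at_bot"
    and lim: "(f \<longlongrightarrow> c) F"
  shows "f t = c"
proof -
  have up: "f (u + real n * T) = f u" for n u
  proof (induction n)
    case (Suc n)
    have "u + real (Suc n) * T = (u + real n * T) + T"
      by (simp add: algebra_simps)
    then show ?case
      using Suc per[of "u + real n * T"] by (simp only:)
  qed simp
  have down: "f (u + - real n * T) = f u" for n u
    using up[of "u + - real n * T" n] by simp
  have at_top: "filterlim (\<lambda>n. u + real n * T) at_top sequentially" for u
    by (rule filterlim_tendsto_add_at_top[OF tendsto_const
          filterlim_at_top_mult_tendsto_pos[OF tendsto_const T filterlim_real_sequentially]])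
  have at_bot: "filterlim (\<lambda>n. t + - real n * T) at_bot sequentially"
    unfolding filterlim_uminus_at_bot using at_top[of "- t"] by simp
  have "(\<lambda>n. f t) \<longlonglongrightarrow> c"
    using F
  proof
    assume "F = at_top"
    with filterlim_compose[OF lim] at_top have "(\<lambda>n. f (t + real n * T)) \<longlonglongrightarrow> c" by blast
    then show ?thesis by (simp only: up)
  next
    assume "F = at_bot"
    with filterlim_compose[OF lim] at_bot have "(\<lambda>n. f (t + - real n * T)) \<longlonglongrightarrow> c" by blast
    then show ?thesis by (simp only: down)
  qed
  then show ?thesis
    by (simp add: LIMSEQ_const_iff)
qed

lemma periodic_asymptotic_subset:
  assumes "T > 0" "\<And>t. \<gamma> (t + T) = \<gamma> t" "F = at_top \<or> F = at_bot" "asymptotic_to \<gamma> C F"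
    and "closed C" "C \<noteq> {}"
  shows "\<gamma> t \<in> C"
proof -
  have "infdist (\<gamma> (t + T)) C = infdist (\<gamma> t) C" for t
    by (simp only: assms(2))
  then have "infdist (\<gamma> t) C = 0"
    by (rule periodic_tendsto_const[OF assms(1) _ assms(3) assms(4)[unfolded asymptotic_to_def]])
  then show ?thesis
    using assms(5,6) by (simp add: in_closed_iff_infdist_zero)
qed

lemma closed_leaves_nonreal:
  assumes a: "a \<notin> \<real>"
  shows "{L. closed_leaf a L} = {hopf1, hopf2}"
proof -
  have "L \<in> {hopf1, hopf2}" if L: "closed_leaf a L" for L
  proof (rule ccontr)
    assume n: "L \<notin> {hopf1, hopf2}"
    obtain \<gamma> T where \<gamma>: "orbit_param a L \<gamma>" "T > 0" "\<And>t. \<gamma> (t + T) = \<gamma> t"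
      using L by (auto simp: closed_leaf_def)
    have "L \<in> leaves a - {hopf1, hopf2}"
      using L n by (simp add: closed_leaf_def)
    then have *: "asymptotic_to \<gamma> hopf1 at_bot \<and> asymptotic_to \<gamma> hopf2 at_top \<or>
         asymptotic_to \<gamma> hopf2 at_bot \<and> asymptotic_to \<gamma> hopf1 at_top"
      using leaf_asymptotic_nonreal[OF a] \<gamma>(1) unfolding leaf_asymptotic_to_both_def by blast
    have "closed hopf1" "closed hopf2" "hopf1 \<noteq> {}" "hopf2 \<noteq> {}"
      by (auto simp: hopf1_def hopf2_def intro!: closed_Times)
    note hopf = this
    note sub = periodic_asymptotic_subset[of T \<gamma>, OF \<gamma>(2,3)]
    have "\<gamma> 0 \<in> hopf1 \<and> \<gamma> 0 \<in> hopf2"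
      using * sub[of at_bot hopf1 0] sub[of at_top hopf1 0] sub[of at_bot hopf2 0]
        sub[of at_top hopf2 0] hopf by blast
    then show False
      by (auto simp: hopf1_def hopf2_def)
  qed
  moreover have "a \<noteq> 0" "a \<noteq> 1" using a by auto
  ultimately show ?thesis
    using closed_leaf_hopf1 closed_leaf_hopf2 by blast
qed

section \<open>Real parameters\<close>

text \<open>Both exponents have the sign of \<open>Re w\<close>, so moving away from \<open>Re w = 0\<close> scales both
  coordinates up or both down, and the point leaves the sphere. The factor \<open>1\<close> on the right gives the condition the
  form that \<open>orbit_param_imaginary_line\<close> asks for.\<close>
lemma linear_flow_real_in_S3_iff:
  fixes a :: real
  assumes a: "0 < a" "a < 1" and p: "p \<in> S3"
  shows "linear_flow a w p \<in> S3 \<longleftrightarrow> Re (1 * w) = 0"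
proof -
  define x where "x = Re w"
  define u where "u = (cmod (fst p))\<^sup>2"
  define v where "v = (cmod (snd p))\<^sup>2"
  have uv: "u \<ge> 0" "v \<ge> 0" "u + v = 1"
    using p unfolding mem_S3_iff by (auto simp: u_def v_def)
  have S: "linear_flow a w p \<in> S3 \<longleftrightarrow> u * exp (2 * (a * x)) + v * exp (2 * ((1 - a) * x)) = 1"
    unfolding linear_flow_in_S3_iff u_def v_def x_def
    by (simp add: power_mult_distrib exp_double)
  have "x = 0" if e: "u * exp (2 * (a * x)) + v * exp (2 * ((1 - a) * x)) = 1"
  proof -
    have z: "u * (exp (2 * (a * x)) - 1) + v * (exp (2 * ((1 - a) * x)) - 1) = 0"
      using e uv by (simp add: algebra_simps)
    consider "x > 0" | "x < 0" | "x = 0" by linarith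
    then show ?thesis
    proof cases
      case 1
      then have "exp (2 * (a * x)) - 1 > 0" "exp (2 * ((1 - a) * x)) - 1 > 0"
        using a by simp_all
      with z uv show ?thesis
        by (smt (verit) mult_nonneg_nonneg mult_pos_pos)
    next
      case 2
      then have "1 - exp (2 * (a * x)) > 0" "1 - exp (2 * ((1 - a) * x)) > 0"
        using a by (simp_all add: mult_pos_neg)
      moreover have "u * (1 - exp (2 * (a * x))) + v * (1 - exp (2 * ((1 - a) * x))) = 0"
        using z by (simp add: algebra_simps)
      ultimately show ?thesis
        using uv by (smt (verit) mult_nonneg_nonneg mult_pos_pos)
    qed
  qed
  then show ?thesis
    unfolding S using uv by (auto simp: x_def)
qed

text \<open>At the imaginary time \<open>\<i> t\<close> the flow adds \<open>a t\<close> to the first angle and \<open>(1 - a) t\<close> to the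
  second one. The curve is therefore a straight line in the universal cover of the torus, and the
  constant \<open>c\<close> is read off at \<open>p\<close>.\<close>
lemma leaf_real_slope_curve:
  fixes a :: real
  assumes a: "0 < a" "a < 1" and p: "p \<in> S3" "fst p \<noteq> 0" "snd p \<noteq> 0"
  defines "r \<equiv> cmod (fst p)" and "c \<equiv> Arg (snd p) - Arg (fst p) / (a / (1 - a))"
  shows "leaf a p = slope_curve r (a / (1 - a)) c"
proof -
  have r': "sqrt (1 - r\<^sup>2) = cmod (snd p)"
    using p(1) unfolding mem_S3_iff r_def by (metis add_diff_cancel_left' norm_ge_zero real_sqrt_unique)
  have "complex_of_real a \<noteq> 0" "complex_of_real a \<noteq> 1"
    using a by auto
  from orbit_param_imaginary_line[OF this p(1) one_neq_zero linear_flow_real_in_S3_iff[OF a p(1)]]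
  have "leaf a p = range (\<lambda>t. linear_flow a (\<i> * of_real t) p)"
    by (simp add: orbit_param_def)
  moreover have "linear_flow a (\<i> * of_real t) p =
      torus_point r (Arg (fst p) + a * t) (Arg (snd p) + (1 - a) * t)" for t
  proof -
    have polar: "w * cis s = of_real (cmod w) * cis (Arg w + s)" for w s
      using rcis_cmod_Arg[of w] unfolding rcis_def cis_mult[symmetric] by (metis mult.assoc)
    have "exp (of_real b * (\<i> * of_real t)) = cis (b * t)" for b
      by (simp add: cis_conv_exp mult_ac)
    from this[of a] this[of "1 - a"] show ?thesis
      unfolding linear_flow_def torus_point_def r'
      by (simp add: r_def polar[of "fst p" "a * t"] polar[of "snd p" "(1 - a) * t"])
  qed
  ultimately have L: "leaf a p = range (\<lambda>t. torus_point r (Arg (fst p) + a * t) (Arg (snd p) + (1 - a) * t))"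
    by simp
  show ?thesis
  proof (intro equalityI subsetI)
    fix z assume "z \<in> leaf a p"
    then obtain t where "z = torus_point r (Arg (fst p) + a * t) (Arg (snd p) + (1 - a) * t)"
      unfolding L by blast
    moreover have "(Arg (snd p) + (1 - a) * t) - (Arg (fst p) + a * t) / (a / (1 - a)) = c"
      using a by (simp add: c_def field_simps)
    ultimately show "z \<in> slope_curve r (a / (1 - a)) c"
      unfolding slope_curve_def by blast
  next
    fix z assume "z \<in> slope_curve r (a / (1 - a)) c"
    then obtain x y where z: "z = torus_point r x y" and xy: "y - x / (a / (1 - a)) = c"
      unfolding slope_curve_def by blast
    define t where "t = (x - Arg (fst p)) / a"
    have "x = Arg (fst p) + a * t"
      using a by (simp add: t_def)
    moreover have "y = Arg (snd p) + (1 - a) * t"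
      using xy a by (simp add: t_def c_def field_simps)
    ultimately show "z \<in> leaf a p"
      unfolding L z by blast
  qed
qed

lemma slope_curve_subset_hopf_torus:
  assumes "0 \<le> r" "r \<le> 1"
  shows "slope_curve r s c \<subseteq> hopf_torus r"
proof -
  have "r\<^sup>2 \<le> 1"
    using assms by (simp add: power_le_one)
  then have "torus_point r x y \<in> hopf_torus r" for x y
    using assms unfolding hopf_torus_def mem_Collect_eq mem_S3_iff
    by (simp add: torus_point_def norm_mult)
  then show ?thesis
    unfolding slope_curve_def by blast
qed

theorem proposition6p1:
  "(\<forall>a::complex. a \<notin> \<real> \<longrightarrow>
      {L. closed_leaf a L} = {hopf1, hopf2} \<and>
      (\<forall>L \<in> leaves a - {hopf1, hopf2}. leaf_asymptotic_to_both a L hopf1 hopf2)) \<and>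
   (\<forall>a::real. 0 < a \<and> a < 1 \<longrightarrow>
      (\<forall>L \<in> leaves (complex_of_real a) - {hopf1, hopf2}.
         \<exists>r c. 0 < r \<and> r < 1 \<and> L \<subseteq> hopf_torus r \<and> L = slope_curve r (a / (1 - a)) c))"
proof (intro conjI allI impI ballI)
  fix a :: complex assume "a \<notin> \<real>"
  then show "{L. closed_leaf a L} = {hopf1, hopf2}"
    and "\<And>L. L \<in> leaves a - {hopf1, hopf2} \<Longrightarrow> leaf_asymptotic_to_both a L hopf1 hopf2"
    by (rule closed_leaves_nonreal, rule leaf_asymptotic_nonreal)
next
  fix a :: real and L
  assume a: "0 < a \<and> a < 1" and L: "L \<in> leaves (complex_of_real a) - {hopf1, hopf2}"
  then have "complex_of_real a \<noteq> 0" "complex_of_real a \<noteq> 1"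
    by auto
  then obtain p where p: "p \<in> S3" "fst p \<noteq> 0" "snd p \<noteq> 0" "L = leaf a p"
    using non_hopf_leaf L by blast
  define r where "r = cmod (fst p)"
  have "0 < r" using p by (simp add: r_def)
  moreover have "r < 1"
  proof -
    have "0 < (cmod (snd p))\<^sup>2" using p(3) by simp
    then have "r\<^sup>2 < 1\<^sup>2" using p(1) unfolding mem_S3_iff r_def one_power2 by linarith
    then show ?thesis by (rule power2_less_imp_less) simp
  qed
  ultimately show "\<exists>r c. 0 < r \<and> r < 1 \<and> L \<subseteq> hopf_torus r \<and> L = slope_curve r (a / (1 - a)) c"
    using leaf_real_slope_curve[of a p] slope_curve_subset_hopf_torus[of r] a p
    unfolding r_def by (metis less_imp_le)
qed

end
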